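(* Let $2 \le d < \infty$ be an integer. The code $\mathcal{C}_{(2,d,d)}$ (defined in the context) has a non-degenerate convex realization in $\mathbb{R}^d$.
   Context: A code is a collection $\mathcal{C} \subseteq 2^{S}$ of subsets of a finite set $S$, where $S$ is called a base set for $\mathcal{C}$; its elements are called codewords. By convention $\emptyset$ is a codeword of every code. Write $[d] = \{1,\dots,d\}$. For a collection $\mathcal{U} = \{U_i\}_{i \in S}$ of subsets of $\mathbb{R}^m$ indexed by $S$ (sets in the collection may be empty), the code of $\mathcal{U}$ is $$\operatorname{code}(\mathcal{U}) = \{\sigma \subseteq S \mid \text{there exists } p \in \mathbb{R}^m \text{ such that } p \in U_i \text{ if and only if } i \in \sigma\},$$ and $\mathcal{U}$ is called a realization of $\operatorname{code}(\mathcal{U})$. A collection $\mathcal{U} = \{U_i\}$ of convex open sets is non-degenerate if $\operatorname{code}(\{\operatorname{cl}(U_i)\}) = \operatorname{code}(\mathcal{U})$. A collection $\mathcal{X} = \{X_i\}$ of closed convex sets is non-degenerate if $\operatorname{code}(\{\operatorname{int}(X_i)\}) = \operatorname{code}(\mathcal{X})$. Here $\operatorname{cl}$ and $\operatorname{int}$ denote closure and interior in $\mathbb{R}^m$. A non-degenerate realization of a code is a realization that is a non-degenerate collection (open or closed) in this sense. The code $\mathcal{C}_{(2,d,d)}$: for $2 \le d < \infty$, take $4d$ distinct formal symbols $\alpha_i, \beta_i, \gamma_i, \delta_i$ ($i \in [d]$), and write $\alpha_{[d]} = \{\alpha_1,\dots,\alpha_d\}$ and similarly $\beta_{[d]}, \gamma_{[d]},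 \delta_{[d]}$. Then $\mathcal{C}_{(2,d,d)}$ is the code on the base set $\alpha_{[d]} \cup \beta_{[d]} \cup \gamma_{[d]} \cup \delta_{[d]}$ consisting of $\emptyset$ and exactly the following nonempty codewords: (i) $\{\beta_i, \gamma_i\}$ for $i \in [d]$; (ii) $\{\beta_i, \beta_{i+1}, \gamma_i\}$ for $i \in [d-1]$; (iii) $\{\beta_i, \beta_{i+1}\}$ for $i \in [d-1]$; (iv) $\{\beta_i, \beta_{i+1}, \gamma_{i+1}\}$ for $i \in [d-1]$; (v) $\{\alpha_i, \beta_i, \gamma_i, \delta_i\}$ for $i \in [d]$; (vi) $\{\alpha_i, \delta_i\}$ for $i \in [d]$; (vii) $\alpha_{[d]} \cup \delta_{[d]}$; (viii) $\delta_{[d]}$. *)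

theory Defs
  imports "HOL-Analysis.Analysis"
begin

text \<open>
  A collection indexed by a finite set \<open>S\<close> is a function on the index type; only its values on
  \<open>S\<close> matter. In \<open>code_of S U\<close>, as in the paper's formula, the empty set is a codeword exactly
  when some point of the space lies in no member of the collection; it is not added by fiat.
\<close>

definition code_of :: "'i set \<Rightarrow> ('i \<Rightarrow> 'a set) \<Rightarrow> 'i set set" where
  "code_of S U = {\<sigma>. \<sigma> \<subseteq> S \<and> (\<exists>p. \<forall>i\<in>S. p \<in> U i \<longleftrightarrow> i \<in> \<sigma>)}"

definition realization :: "'i set set \<Rightarrow> 'i set \<Rightarrow> ('i \<Rightarrow> 'a set) \<Rightarrow> bool" where
  "realization C S U \<longleftrightarrow> code_of S U = C"

definition nondegenerate_open :: "'i set \<Rightarrow> ('i \<Rightarrow> 'a::euclidean_space set) \<Rightarrow> bool" where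
  "nondegenerate_open S U \<longleftrightarrow>
     (\<forall>i\<in>S. convex (U i) \<and> open (U i)) \<and> code_of S (\<lambda>i. closure (U i)) = code_of S U"

definition nondegenerate_closed :: "'i set \<Rightarrow> ('i \<Rightarrow> 'a::euclidean_space set) \<Rightarrow> bool" where
  "nondegenerate_closed S X \<longleftrightarrow>
     (\<forall>i\<in>S. convex (X i) \<and> closed (X i)) \<and> code_of S (\<lambda>i. interior (X i)) = code_of S X"

definition nondegenerate_convex_realization ::
    "'i set set \<Rightarrow> 'i set \<Rightarrow> ('i \<Rightarrow> 'a::euclidean_space set) \<Rightarrow> bool" where
  "nondegenerate_convex_realization C S U \<longleftrightarrow>
     realization C S U \<and> (nondegenerate_open S U \<or> nondegenerate_closed S U)"

datatype symb = Alpha nat | Beta nat | Gamma nat | Delta nat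

definition base_2dd :: "nat \<Rightarrow> symb set" where
  "base_2dd d = Alpha ` {1..d} \<union> Beta ` {1..d} \<union> Gamma ` {1..d} \<union> Delta ` {1..d}"

text \<open>The index range \<open>i \<in> [d-1]\<close> is written \<open>{1..<d}\<close>.\<close>

definition code_2dd :: "nat \<Rightarrow> symb set set" where
  "code_2dd d =
     {{}}
   \<union> {{Beta i, Gamma i} | i. i \<in> {1..d}}
   \<union> {{Beta i, Beta (i + 1), Gamma i} | i. i \<in> {1..<d}}
   \<union> {{Beta i, Beta (i + 1)} | i. i \<in> {1..<d}}
   \<union> {{Beta i, Beta (i + 1), Gamma (i + 1)} | i. i \<in> {1..<d}}
   \<union> {{Alpha i, Beta i, Gamma i, Delta i} | i. i \<in> {1..d}}
   \<union> {{Alpha i, Delta i} | i. i \<in> {1..d}}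
   \<union> {Alpha ` {1..d} \<union> Delta ` {1..d}}
   \<union> {Delta ` {1..d}}"

end

theory Submission
  imports Defs
begin

text \<open>
  Number the \<open>d\<close> coordinates of the space from \<open>1\<close> to \<open>d\<close>. The set of \<open>\<delta>\<^sub>i\<close> is the unit cube
  extended without bound in the \<open>i\<close>-th direction; two such tubes meet exactly in the cube, so the
  tubes form a sunflower whose centre is the cube. The set of \<open>\<alpha>\<^sub>i\<close> is the part of the \<open>i\<close>-th tube
  above the hyperplane \<open>\<Sum>\<^sub>k x\<^sub>k = 1 / 2\<close>. Everything that is cut off lies in the cube, so a point
  of the \<open>i\<close>-th tube outside the \<open>i\<close>-th \<open>\<alpha>\<close>-set belongs to all the tubes and to no \<open>\<alpha>\<close>-set. This
  accounts for the codewords without \<open>\<beta>\<close> and \<open>\<gamma>\<close>.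

  Far from the origin, in a slab \<open>L \<le> \<Sum>\<^sub>k x\<^sub>k \<le> L + 1\<close>, the tubes are disjoint: the \<open>i\<close>-th one crosses
  the slab only near the vertex \<open>L e\<^sub>i\<close> of a large simplex. Consider the linear functional
  \<open>x \<mapsto> (\<Sum>\<^sub>k k x\<^sub>k) / L\<close>, called the position of \<open>x\<close>. It has the value \<open>i\<close> at the \<open>i\<close>-th vertex,
  and if \<open>L\<close> is of order \<open>d\<^sup>2\<close> the \<open>i\<close>-th tube meets the slab only at positions within \<open>1 / 5\<close> of
  \<open>i\<close> (\<open>tube_crosses_slab_near_vertex\<close>). So the \<open>\<beta>\<close>- and \<open>\<gamma>\<close>-sets can be slices of the slab by
  position: the \<open>\<beta>\<^sub>i\<close>-slice reaches \<open>2 / 3\<close> to either side of \<open>i\<close>, hence overlaps its two neighbours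
  only, and the \<open>\<gamma>\<^sub>i\<close>-slice reaches \<open>2 / 5\<close>. Since \<open>1 / 3 < 2 / 5 < 1 / 2\<close>, the \<open>\<gamma>\<close>-slices are
  disjoint, each of them covers the part of its \<open>\<beta>\<close>-slice that no other \<open>\<beta>\<close>-slice covers and
  reaches a little into the overlaps, and the middle of each overlap stays free of \<open>\<gamma>\<close>. Moving the
  position from \<open>1\<close> to \<open>d\<close> away from the tubes reads off the codewords in \<open>\<beta>\<close> and \<open>\<gamma>\<close> in their
  order along the chain, and a tube adds \<open>\<alpha>\<^sub>i\<close> and \<open>\<delta>\<^sub>i\<close> well inside \<open>\<gamma>\<^sub>i\<close>.

  For non-degeneracy, all the sets are given by finitely many linear inequalities between non-constant
  functionals and constants, so passing from closed sets to interiors turns each \<open>\<le>\<close> into \<open><\<close>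
  (\<open>interior_layout\<close>). All the numerical margins above are strict, so the code does not depend on
  how the boundary cases are decided. It is therefore computed once (\<open>code_of_layout\<close>), for sets
  defined with an arbitrary relation that contains \<open><\<close> and is contained in \<open>\<le>\<close>.
\<close>

section \<open>The sets\<close>

abbreviation coord_sum :: "real ^ 'n::finite \<Rightarrow> real" where
  "coord_sum x \<equiv> (\<Sum>k\<in>UNIV. x $ k)"

text \<open>
  The quadratic growth is what makes the error terms in \<open>tube_crosses_slab_near_vertex\<close>, at most
  \<open>d\<^sup>2 + d \<le> 2 d\<^sup>2\<close> before normalisation, no larger than a fifth of the level.
\<close>

definition slab_level :: "nat \<Rightarrow> real" where
  "slab_level n = 10 * (real n)\<^sup>2"

definition position :: "('n::finite \<Rightarrow> nat) \<Rightarrow> real ^ 'n \<Rightarrow> real" where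
  "position c x = (\<Sum>k\<in>UNIV. real (c k) * x $ k) / slab_level CARD('n)"

text \<open>
  In all the following sets \<open>r\<close> stands for \<open>\<le>\<close> or \<open><\<close>, and \<open>c\<close> numbers the coordinates.
\<close>

definition tube :: "(real \<Rightarrow> real \<Rightarrow> bool) \<Rightarrow> ('n::finite \<Rightarrow> nat) \<Rightarrow> nat \<Rightarrow> (real ^ 'n) set" where
  "tube r c i = (\<Inter>k. {x. r 0 (x $ k)}) \<inter> (\<Inter>k\<in>{k. c k \<noteq> i}. {x. r (x $ k) 1})"

text \<open>
  The bounds on the position cut off the two ends of the chain: beyond them the first and the last
  \<open>\<beta>\<close>-slice would stick out of their \<open>\<gamma>\<close>-slices, producing the forbidden codewords \<open>{\<beta>\<^sub>1}\<close> and
  \<open>{\<beta>\<^sub>d}\<close>. The margin \<open>1 / 4\<close> exceeds \<open>1 / 5\<close>, so the tubes cross the slab in between, and stays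
  below \<open>1 / 3\<close>.
\<close>

definition slab :: "(real \<Rightarrow> real \<Rightarrow> bool) \<Rightarrow> ('n::finite \<Rightarrow> nat) \<Rightarrow> (real ^ 'n) set" where
  "slab r c =
     {x. r (slab_level CARD('n)) (coord_sum x)} \<inter> {x. r (coord_sum x) (slab_level CARD('n) + 1)} \<inter>
     {x. r (3 / 4) (position c x)} \<inter> {x. r (position c x) (real CARD('n) + 1 / 4)}"

definition window ::
    "(real \<Rightarrow> real \<Rightarrow> bool) \<Rightarrow> ('n::finite \<Rightarrow> nat) \<Rightarrow> nat \<Rightarrow> real \<Rightarrow> (real ^ 'n) set" where
  "window r c i w = {x. r (real i - w) (position c x)} \<inter> {x. r (position c x) (real i + w)}"

primrec layout ::
    "(real \<Rightarrow> real \<Rightarrow> bool) \<Rightarrow> ('n::finite \<Rightarrow> nat) \<Rightarrow> symb \<Rightarrow> (real ^ 'n) set" where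
  "layout r c (Alpha i) = tube r c i \<inter> {x. r (1 / 2) (coord_sum x)}"
| "layout r c (Beta i) = slab r c \<inter> window r c i (2 / 3)"
| "layout r c (Gamma i) = slab r c \<inter> window r c i (2 / 5)"
| "layout r c (Delta i) = tube r c i"

section \<open>Convexity, closedness and interiors\<close>

lemma coord_sum_eq_inner: "coord_sum x = (\<chi> k. 1) \<bullet> (x :: real ^ 'n::finite)"
  by (simp add: inner_vec_def)

lemma position_eq_inner:
  "position c x = (\<chi> k. real (c k) / slab_level CARD('n)) \<bullet> (x :: real ^ 'n::finite)"
  by (simp add: inner_vec_def position_def sum_divide_distrib)

lemma convex_layout:
  fixes c :: "'n::finite \<Rightarrow> nat"
  shows "convex (layout (\<le>) c s)"
proof -
  have "convex {x :: real ^ 'n. 0 \<le> x $ k}" "convex {x :: real ^ 'n. x $ k \<le> 1}" for k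
    using convex_halfspace_ge[of 0 "axis k 1 :: real ^ 'n"]
      convex_halfspace_le[of "axis k 1 :: real ^ 'n" 1]
    by (simp_all add: inner_axis' inner_real_def)
  then show ?thesis
    by (cases s; simp only: layout.simps tube_def slab_def window_def coord_sum_eq_inner
        position_eq_inner; intro convex_Int convex_INT convex_halfspace_le convex_halfspace_ge)
qed

lemma closed_layout: "closed (layout (\<le>) c s)"
  by (cases s; simp only: layout.simps tube_def slab_def window_def coord_sum_eq_inner
      position_eq_inner; intro closed_Int closed_INT ballI closed_halfspace_le closed_halfspace_ge
      closed_halfspace_component_le_cart closed_halfspace_component_ge_cart)

lemma interior_INT_finite:
  assumes "finite A"
  shows "interior (\<Inter>i\<in>A. S i) = (\<Inter>i\<in>A. interior (S i))"
  using assms by (induction A rule: finite_induct) simp_all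

locale numbered_coordinates =
  fixes c :: "'n::finite \<Rightarrow> nat" and d :: nat
  assumes dim: "CARD('n) = d" and dim_ge_2: "2 \<le> d" and numbering: "bij_betw c UNIV {1..d}"
begin

abbreviation L :: real where "L \<equiv> slab_level d"

lemma L_eq: "L = 10 * (real d)\<^sup>2"
  by (simp add: slab_level_def)

lemma L_ge_40: "40 \<le> L"
proof -
  have "(2::real)\<^sup>2 \<le> (real d)\<^sup>2"
    using dim_ge_2 by (intro power_mono) auto
  then show ?thesis by (simp add: L_eq)
qed

lemma c_range: "1 \<le> c k" "c k \<le> d"
  using bij_betwE[OF numbering] by auto

lemma obtain_index:
  assumes "i \<in> {1..d}"
  obtains k where "c k = i"
  using assms numbering that by (metis bij_betw_def image_iff)

text \<open>
  Interiors commute with finite intersections, and the interior of a closed half-space is the open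
  one as soon as its normal vector is not zero.
\<close>

lemma interior_layout: "interior (layout (\<le>) c s) = layout (<) c s"
proof -
  have nonzero: "(\<chi> k. 1) \<noteq> (0 :: real ^ 'n)" "(\<chi> k. real (c k) / slab_level CARD('n)) \<noteq> 0"
    using c_range(1) L_ge_40 by (auto simp: vec_eq_iff Suc_le_eq dim)
  show ?thesis
    by (cases s; simp only: layout.simps tube_def slab_def window_def coord_sum_eq_inner
        position_eq_inner interior_Int interior_INT_finite[OF finite] nonzero simp_thms
        interior_halfspace_le interior_halfspace_ge interior_halfspace_component_le
        interior_halfspace_component_ge)
qed

section \<open>Where the tubes cross the slab\<close>

text \<open>
  In \<open>L * position x - i * \<Sum>\<^sub>k x\<^sub>k = \<Sum>\<^sub>k (k - i) x\<^sub>k\<close> the one coordinate that a point of the \<open>i\<close>-th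
  tube may have large is multiplied by zero, so the difference is at most \<open>d\<^sup>2\<close>; replacing the
  coordinate sum by \<open>L\<close> costs at most \<open>d\<close> more.
\<close>

lemma tube_crosses_slab_near_vertex:
  assumes i: "i \<in> {1..d}" and x: "x \<in> tube (\<le>) c i" and tot: "L \<le> coord_sum x" "coord_sum x \<le> L + 1"
  shows "\<bar>position c x - real i\<bar> \<le> 1 / 5"
proof -
  have bound: "\<bar>(real (c k) - real i) * x $ k\<bar> \<le> real d" for k
  proof (cases "c k = i")
    case False
    with x have "\<bar>x $ k\<bar> \<le> 1" by (auto simp: tube_def)
    moreover have "\<bar>real (c k) - real i\<bar> \<le> real d" using c_range[of k] i by auto
    ultimately have "\<bar>real (c k) - real i\<bar> * \<bar>x $ k\<bar> \<le> real d * 1"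
      by (intro mult_mono) auto
    then show ?thesis by (simp add: abs_mult)
  qed simp
  have "\<bar>\<Sum>k\<in>UNIV. (real (c k) - real i) * x $ k\<bar> \<le> (\<Sum>k\<in>(UNIV::'n set). real d)"
    by (rule order.trans[OF sum_abs]) (intro sum_mono bound)
  also have "\<dots> = (real d)\<^sup>2" by (simp add: dim power2_eq_square)
  also have "(\<Sum>k\<in>UNIV. (real (c k) - real i) * x $ k) =
      (\<Sum>k\<in>UNIV. real (c k) * x $ k) - real i * coord_sum x"
    by (simp add: left_diff_distrib sum_subtractf sum_distrib_left)
  also have "(\<Sum>k\<in>UNIV. real (c k) * x $ k) = L * position c x"
    using L_ge_40 by (simp add: position_def dim)
  finally have 1: "\<bar>L * position c x - real i * coord_sum x\<bar> \<le> (real d)\<^sup>2" .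
  have "\<bar>real i * (coord_sum x - L)\<bar> \<le> real d * 1"
    unfolding abs_mult using i tot by (intro mult_mono) auto
  also have "\<dots> \<le> (real d)\<^sup>2" using dim_ge_2 by (simp add: power2_eq_square)
  finally have 2: "\<bar>real i * coord_sum x - real i * L\<bar> \<le> (real d)\<^sup>2" by (simp add: algebra_simps)
  have "L * \<bar>position c x - real i\<bar> = \<bar>L * position c x - real i * L\<bar>"
    using L_ge_40 by (simp add: mult.commute[of _ L] abs_mult flip: right_diff_distrib)
  also have "\<dots> \<le> L * (1 / 5)" using 1 2 L_eq by linarith
  finally show ?thesis using L_ge_40 by simp
qed

text \<open>
  Two coordinates suffice: their numbers \<open>1\<close> and \<open>2\<close> make the two linear conditions independent.
\<close>

lemma obtain_point_at_position:
  obtains x where "coord_sum x = L + 1 / 2" "position c x = t"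
proof -
  have "1 \<in> {1..d}" "2 \<in> {1..d}" using dim_ge_2 by auto
  then obtain k l where kl: "c k = 1" "c l = 2" by (metis obtain_index)
  then have "k \<noteq> l" by auto
  define b where "b = t * L - (L + 1 / 2)"
  define x :: "real ^ 'n" where "x = axis k (L + 1 / 2 - b) + axis l b"
  have sums: "(\<Sum>j\<in>UNIV. w j * x $ j) = w k * (L + 1 / 2 - b) + w l * b" for w
    by (simp add: x_def axis_def distrib_left sum.distrib if_distrib[of "(*) _"] cong: if_cong)
  show thesis
  proof
    show "coord_sum x = L + 1 / 2" using sums[of "\<lambda>_. 1"] by simp
    show "position c x = t"
      using sums[of "\<lambda>j. real (c j)"] kl L_ge_40
      by (simp add: dim position_def b_def field_simps)
  qed
qed

end

section \<open>The code of the sets\<close>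

lemma code_2dd_intros:
  "{} \<in> code_2dd d"
  "i \<in> {1..d} \<Longrightarrow> {Beta i, Gamma i} \<in> code_2dd d"
  "i \<in> {1..<d} \<Longrightarrow> {Beta i, Beta (i + 1), Gamma i} \<in> code_2dd d"
  "i \<in> {1..<d} \<Longrightarrow> {Beta i, Beta (i + 1)} \<in> code_2dd d"
  "i \<in> {1..<d} \<Longrightarrow> {Beta i, Beta (i + 1), Gamma (i + 1)} \<in> code_2dd d"
  "i \<in> {1..d} \<Longrightarrow> {Alpha i, Beta i, Gamma i, Delta i} \<in> code_2dd d"
  "i \<in> {1..d} \<Longrightarrow> {Alpha i, Delta i} \<in> code_2dd d"
  "Alpha ` {1..d} \<union> Delta ` {1..d} \<in> code_2dd d"
  "Delta ` {1..d} \<in> code_2dd d"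
  unfolding code_2dd_def Setcompr_eq_image Un_iff singleton_iff
  by (simp_all only: rev_image_eqI simp_thms)

definition word_at :: "'i set \<Rightarrow> ('i \<Rightarrow> 'a set) \<Rightarrow> 'a \<Rightarrow> 'i set" where
  "word_at S U p = {i \<in> S. p \<in> U i}"

lemma code_of_eq_range: "code_of S U = range (word_at S U)"
  by (auto simp: code_of_def word_at_def image_iff)

text \<open>
  The common abstraction of \<open>\<le>\<close> and \<open><\<close>. Facts derived here cannot see on which side a boundary
  point falls; a positive instance of \<open>r\<close> yields \<open>\<le>\<close>, and so does a negated one, in reverse.
\<close>

locale loose_comparison = numbered_coordinates c d
  for c :: "'n::finite \<Rightarrow> nat" and d :: nat +
  fixes r :: "real \<Rightarrow> real \<Rightarrow> bool"
  assumes less_imp_r: "x < y \<Longrightarrow> r x y" and r_imp_le: "r x y \<Longrightarrow> x \<le> y"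
begin

lemma not_r_imp_ge: "\<not> r x y \<Longrightarrow> y \<le> x"
  using less_imp_r by (meson not_le)

abbreviation word :: "real ^ 'n \<Rightarrow> symb set" where
  "word p \<equiv> word_at (base_2dd d) (layout r c) p"

lemma word_eqI:
  assumes "\<And>i. i \<in> {1..d} \<Longrightarrow> p \<in> layout r c (Alpha i) \<longleftrightarrow> i \<in> A"
    and "\<And>i. i \<in> {1..d} \<Longrightarrow> p \<in> layout r c (Beta i) \<longleftrightarrow> i \<in> B"
    and "\<And>i. i \<in> {1..d} \<Longrightarrow> p \<in> layout r c (Gamma i) \<longleftrightarrow> i \<in> G"
    and "\<And>i. i \<in> {1..d} \<Longrightarrow> p \<in> layout r c (Delta i) \<longleftrightarrow> i \<in> D"
    and "A \<subseteq> {1..d}" "B \<subseteq> {1..d}" "G \<subseteq> {1..d}" "D \<subseteq> {1..d}"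
  shows "word p = Alpha ` A \<union> Beta ` B \<union> Gamma ` G \<union> Delta ` D"
  using assms(5-8) by (auto simp: word_at_def base_2dd_def assms(1-4) simp del: layout.simps)

lemma slab_total: "p \<in> slab r c \<Longrightarrow> L \<le> coord_sum p \<and> coord_sum p \<le> L + 1"
  by (auto simp: slab_def dim dest: r_imp_le)

lemma slab_position: "p \<in> slab r c \<Longrightarrow> 3 / 4 \<le> position c p \<and> position c p \<le> real d + 1 / 4"
  by (auto simp: slab_def dim dest: r_imp_le)

lemma in_slabI:
  assumes "L < coord_sum p" "coord_sum p < L + 1" "3 / 4 < position c p" "position c p < real d + 1 / 4"
  shows "p \<in> slab r c"
  using assms by (auto simp: slab_def dim intro!: less_imp_r)

lemma tube_mono: "p \<in> tube r c i \<Longrightarrow> p \<in> tube (\<le>) c i"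
  by (auto simp: tube_def dest: r_imp_le)

lemma tube_near:
  assumes "i \<in> {1..d}" "p \<in> tube r c i" "L \<le> coord_sum p" "coord_sum p \<le> L + 1"
  shows "real i - 1 / 5 \<le> position c p" "position c p \<le> real i + 1 / 5"
  using tube_crosses_slab_near_vertex[OF assms(1) tube_mono[OF assms(2)] assms(3,4)] by linarith+

text \<open>
  The distance \<open>1 / 5\<close> of the position to \<open>i\<close> leaves room on both sides: it puts the point strictly
  inside the slices with index \<open>i\<close>, and its distance to any other index is at least \<open>4 / 5\<close>, beyond
  the reach of all other slices and tubes.
\<close>

lemma word_tube_in_slab:
  assumes i: "i \<in> {1..d}" and p: "p \<in> tube r c i"
    and tot: "r L (coord_sum p)" "r (coord_sum p) (L + 1)"
  shows "word p = {Alpha i, Beta i, Gamma i, Delta i}"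
proof -
  note tot' = tot[THEN r_imp_le]
  note near = tube_near[OF i p tot']
  have slab: "p \<in> slab r c"
    using near i tot by (auto simp: slab_def dim intro!: less_imp_r)
  have tube: "p \<in> tube r c j \<longleftrightarrow> j = i" if "j \<in> {1..d}" for j
    using tube_near[OF that _ tot'] near p by fastforce
  have half: "r (1 / 2) (coord_sum p)" using tot' L_ge_40 by (intro less_imp_r) auto
  have window: "p \<in> window r c j w \<longleftrightarrow> j = i" if "1 / 5 < w" "w < 4 / 5" for j w
  proof
    assume "p \<in> window r c j w"
    then have "real j - w \<le> position c p" "position c p \<le> real j + w"
      by (auto simp: window_def dest: r_imp_le)
    with near that show "j = i" by linarith
  next
    assume "j = i"
    with near that show "p \<in> window r c j w" by (auto simp: window_def intro!: less_imp_r)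
  qed
  have "word p = Alpha ` {i} \<union> Beta ` {i} \<union> Gamma ` {i} \<union> Delta ` {i}"
    by (rule word_eqI) (use i p slab half tube window in auto)
  then show ?thesis by auto
qed

text \<open>
  In the slab and off the tubes a codeword depends on the position only. This is its value where
  two consecutive \<open>\<beta>\<close>-slices overlap.
\<close>

lemma word_between:
  assumes slab: "p \<in> slab r c" and no_tube: "\<And>j. j \<in> {1..d} \<Longrightarrow> p \<notin> tube r c j"
    and i: "i \<in> {1..<d}" and t: "r (real i + 1 / 3) (position c p)" "r (position c p) (real i + 2 / 3)"
  shows "word p = {Beta i, Beta (i + 1)} \<union>
     (if r (position c p) (real i + 2 / 5) then {Gamma i} else {}) \<union>
     (if r (real i + 3 / 5) (position c p) then {Gamma (i + 1)} else {})"
proof -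
  let ?t = "position c p"
  note t' = t[THEN r_imp_le]
  have far: "j = i \<or> j = i + 1" if "p \<in> window r c j w" "w \<le> 2 / 3" for j w
  proof -
    have "real j - w \<le> ?t" "?t \<le> real j + w"
      using that(1) by (auto simp: window_def dest: r_imp_le)
    with t' that(2) have "real i < real j + 1" "real j < real i + 2" by linarith+
    then show ?thesis by linarith
  qed
  have B: "p \<in> window r c j (2 / 3) \<longleftrightarrow> j \<in> {i, i + 1}" for j
  proof
    assume "j \<in> {i, i + 1}"
    then show "p \<in> window r c j (2 / 3)"
      using t t' less_imp_r[of "real i - 2 / 3" ?t] less_imp_r[of ?t "real i + 5 / 3"]
      by (auto simp: window_def algebra_simps)
  qed (use far in auto)
  have G: "p \<in> window r c j (2 / 5) \<longleftrightarrow> j = i \<and> r ?t (real i + 2 / 5) \<or> j = i + 1 \<and> r (real i + 3 / 5) ?t"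
    for j
    using far[of j "2 / 5"] t' less_imp_r[of "real i - 2 / 5" ?t] less_imp_r[of ?t "real i + 7 / 5"]
    by (auto simp: window_def algebra_simps)
  have "word p = Alpha ` {} \<union> Beta ` {i, i + 1} \<union>
      Gamma ` ({j. j = i \<and> r ?t (real i + 2 / 5)} \<union> {j. j = i + 1 \<and> r (real i + 3 / 5) ?t}) \<union>
      Delta ` {}"
    by (rule word_eqI) (use i no_tube slab B G in auto)
  then show ?thesis by auto
qed

text \<open>
  The complementary range of positions. At the two ends of the chain one of the neighbours does not
  exist, hence the guards in the last two assumptions.
\<close>

lemma word_near_vertex:
  assumes slab: "p \<in> slab r c" and no_tube: "\<And>j. j \<in> {1..d} \<Longrightarrow> p \<notin> tube r c j"
    and i: "i \<in> {1..d}" and near: "real i - 1 / 3 \<le> position c p" "position c p \<le> real i + 1 / 3"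
    and above: "i < d \<Longrightarrow> \<not> r (real i + 1 / 3) (position c p)"
    and below: "1 < i \<Longrightarrow> \<not> r (position c p) (real i - 1 / 3)"
  shows "word p = {Beta i, Gamma i}"
proof -
  let ?t = "position c p"
  have B: "p \<in> window r c j (2 / 3) \<longleftrightarrow> j = i" if j: "j \<in> {1..d}" for j
  proof
    assume win: "p \<in> window r c j (2 / 3)"
    then have "real j - 2 / 3 \<le> ?t" "?t \<le> real j + 2 / 3"
      by (auto simp: window_def dest: r_imp_le)
    with near have "real i \<le> real j + 1" "real j \<le> real i + 1" by linarith+
    then consider "j = i" | "j = i + 1" | "i = j + 1" by linarith
    then show "j = i"
      using win above below j i by cases (auto simp: window_def algebra_simps)
  next
    assume "j = i"
    with near show "p \<in> window r c j (2 / 3)" by (auto simp: window_def intro!: less_imp_r)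
  qed
  have G: "p \<in> window r c j (2 / 5) \<longleftrightarrow> j = i" for j
  proof
    assume "p \<in> window r c j (2 / 5)"
    then have "real j - 2 / 5 \<le> ?t" "?t \<le> real j + 2 / 5"
      by (auto simp: window_def dest: r_imp_le)
    with near show "j = i" by linarith
  next
    assume "j = i"
    with near show "p \<in> window r c j (2 / 5)" by (auto simp: window_def intro!: less_imp_r)
  qed
  have "word p = Alpha ` {} \<union> Beta ` {i} \<union> Gamma ` {i} \<union> Delta ` {}"
    by (rule word_eqI) (use i no_tube slab B G in auto)
  then show ?thesis by auto
qed

lemma word_outside_slab:
  assumes "p \<notin> slab r c"
  shows "word p = Alpha ` {i \<in> {1..d}. p \<in> tube r c i \<and> r (1 / 2) (coord_sum p)} \<union>
    Delta ` {i \<in> {1..d}. p \<in> tube r c i}"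
proof -
  have "word p = Alpha ` {i \<in> {1..d}. p \<in> tube r c i \<and> r (1 / 2) (coord_sum p)} \<union> Beta ` {} \<union>
      Gamma ` {} \<union> Delta ` {i \<in> {1..d}. p \<in> tube r c i}"
    by (rule word_eqI) (use assms in auto)
  then show ?thesis by simp
qed

text \<open>
  What makes the tubes a sunflower: leaving aside the points with a large \<open>i\<close>-th coordinate, the
  \<open>i\<close>-th tube is the cube, which lies in every tube.
\<close>

lemma tube_center:
  assumes "p \<in> tube r c i" and "\<And>k. c k = i \<Longrightarrow> r (p $ k) 1"
  shows "p \<in> tube r c j"
  using assms by (auto simp: tube_def)

lemma tube_sunflower:
  assumes "p \<in> tube r c i" "p \<in> tube r c j" "i \<noteq> j"
  shows "p \<in> tube r c l"
proof (rule tube_center[OF assms(1)])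
  show "r (p $ k) 1" if "c k = i" for k
    using assms that by (auto simp: tube_def)
qed

text \<open>
  Nonnegative coordinates with sum at most \<open>1 / 2\<close> are all less than \<open>1\<close>.
\<close>

lemma tube_below_cut:
  assumes p: "p \<in> tube r c i" and "\<not> r (1 / 2) (coord_sum p)"
  shows "p \<in> tube r c j"
proof (rule tube_center[OF p])
  fix k
  have "0 \<le> p $ j" for j using p by (auto simp: tube_def dest: r_imp_le)
  then have "p $ k \<le> coord_sum p" by (intro member_le_sum) auto
  moreover have "coord_sum p \<le> 1 / 2" by (rule not_r_imp_ge) fact
  ultimately show "r (p $ k) 1" by (intro less_imp_r) linarith
qed

text \<open>
  In the slab, the nearest index \<open>i\<close> to the position decides: either the point is in the overlap of
  the \<open>\<beta>\<close>-slices \<open>i\<close> and \<open>i + 1\<close>, or in that of \<open>i - 1\<close> and \<open>i\<close>, or in no overlap. Outside the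
  slab, the sunflower property leaves three cases: no tube, all tubes, or exactly one.
\<close>

lemma word_in_code: "word p \<in> code_2dd d"
proof (cases "p \<in> slab r c")
  case slab: True
  show ?thesis
  proof (cases "\<exists>i\<in>{1..d}. p \<in> tube r c i")
    case True
    then obtain i where i: "i \<in> {1..d}" "p \<in> tube r c i" by blast
    have "word p = {Alpha i, Beta i, Gamma i, Delta i}"
      using slab by (intro word_tube_in_slab i) (auto simp: slab_def dim)
    then show ?thesis using code_2dd_intros(6)[OF i(1)] by simp
  next
    case False
    then have no_tube: "\<And>j. j \<in> {1..d} \<Longrightarrow> p \<notin> tube r c j" by blast
    let ?t = "position c p"
    define i where "i = nat (round ?t)"
    note range = slab_position[OF slab]
    have rnd: "real_of_int (round ?t) - 1 / 2 \<le> ?t" "?t \<le> real_of_int (round ?t) + 1 / 2"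
      using of_int_round_abs_le[of ?t] by linarith+
    then have "0 < round ?t" "round ?t < int d + 1" using range by linarith+
    then have i: "i \<in> {1..d}" and near: "real i - 1 / 2 \<le> ?t" "?t \<le> real i + 1 / 2"
      using rnd by (auto simp: i_def)
    have between: "word p \<in> code_2dd d"
      if j: "j \<in> {1..<d}" "r (real j + 1 / 3) ?t" "r ?t (real j + 2 / 3)" for j
    proof -
      have "\<not> (r ?t (real j + 2 / 5) \<and> r (real j + 3 / 5) ?t)"
        using r_imp_le[of ?t "real j + 2 / 5"] r_imp_le[of "real j + 3 / 5" ?t] by auto
      with word_between[OF slab no_tube j] code_2dd_intros(3-5)[OF j(1)] show ?thesis
        by (cases "r ?t (real j + 2 / 5)"; cases "r (real j + 3 / 5) ?t"; simp add: insert_commute)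
    qed
    consider (above) "i < d" "r (real i + 1 / 3) ?t"
      | (below) "1 < i" "r ?t (real i - 1 / 3)"
      | (vertex) "i < d \<Longrightarrow> \<not> r (real i + 1 / 3) ?t" "1 < i \<Longrightarrow> \<not> r ?t (real i - 1 / 3)"
      by blast
    then show ?thesis
    proof cases
      case above
      with i near show ?thesis by (intro between[of i]) (auto intro!: less_imp_r)
    next
      case below
      with i near show ?thesis
        by (intro between[of "i - 1"]) (auto simp: of_nat_diff intro!: less_imp_r)
    next
      case vertex
      have "?t \<le> real i + 1 / 3"
        using vertex(1) not_r_imp_ge i range by (cases "i < d") force+
      moreover have "real i - 1 / 3 \<le> ?t"
        using vertex(2) not_r_imp_ge i range by (cases "1 < i") force+
      ultimately show ?thesis
        using word_near_vertex[OF slab no_tube i _ _ vertex] code_2dd_intros(2)[OF i]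
        by simp
    qed
  qed
next
  case False
  note word = word_outside_slab[OF False]
  consider (none) "\<And>i. i \<in> {1..d} \<Longrightarrow> p \<notin> tube r c i"
    | (all) "\<And>i. p \<in> tube r c i"
    | (one) i where "i \<in> {1..d}" "p \<in> tube r c i" "\<not> (\<forall>j. p \<in> tube r c j)"
    by blast
  then show ?thesis
  proof cases
    case none
    then have "word p = {}" unfolding word by auto
    then show ?thesis using code_2dd_intros(1,8,9) by (simp split: if_splits)
  next
    case all
    then have "word p = (if r (1 / 2) (coord_sum p) then Alpha ` {1..d} else {}) \<union> Delta ` {1..d}"
      unfolding word by auto
    then show ?thesis using code_2dd_intros(1,8,9) by (simp split: if_splits)
  next
    case one
    have "{j \<in> {1..d}. p \<in> tube r c j} = {i}"
      using one tube_sunflower[OF one(2)] by auto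
    moreover have "r (1 / 2) (coord_sum p)"
      using one(3) tube_below_cut[OF one(2)] by blast
    ultimately have "{j \<in> {1..d}. p \<in> tube r c j \<and> r (1 / 2) (coord_sum p)} = {i}"
      "{j \<in> {1..d}. p \<in> tube r c j} = {i}"
      by auto
    then have "word p = {Alpha i, Delta i}" unfolding word by auto
    then show ?thesis using code_2dd_intros(7)[OF one(1)] by simp
  qed
qed

lemma in_centerI:
  assumes "\<And>k. 0 < p $ k" "\<And>k. p $ k < 1"
  shows "p \<in> tube r c i"
  using assms by (auto simp: tube_def intro!: less_imp_r)

lemma not_in_slabI: "coord_sum p < L \<Longrightarrow> p \<notin> slab r c"
  using slab_total by force

text \<open>
  Conversely each codeword is attained, at points where each relevant inequality holds strictly
  or fails strictly.
\<close>

lemma empty_word: "{} \<in> range word"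
proof -
  define p :: "real ^ 'n" where "p = (\<chi> k. - 1)"
  have "p \<notin> slab r c" using L_ge_40 by (intro not_in_slabI) (simp add: p_def dim)
  moreover have "p \<notin> tube r c i" for i by (auto simp: p_def tube_def dest: r_imp_le)
  ultimately have "word p = {}" by (simp add: word_outside_slab)
  then show ?thesis by (metis rangeI)
qed

lemma center_words:
  "Alpha ` {1..d} \<union> Delta ` {1..d} \<in> range word" "Delta ` {1..d} \<in> range word"
proof -
  define p :: "real \<Rightarrow> real ^ 'n" where "p e = (\<chi> k. e / real d)" for e
  have tot: "coord_sum (p e) = e" for e using dim_ge_2 by (simp add: p_def dim)
  have word: "word (p e) = Alpha ` {i \<in> {1..d}. r (1 / 2) e} \<union> Delta ` {1..d}"
    if "0 < e" "e < 1" for e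
  proof -
    have "p e \<in> tube r c i" for i
      using that dim_ge_2 by (intro in_centerI) (auto simp: p_def)
    moreover have "p e \<notin> slab r c"
      using that L_ge_40 by (intro not_in_slabI) (simp add: tot)
    ultimately show ?thesis by (auto simp: word_outside_slab tot)
  qed
  have "r (1 / 2) (3 / 4)" by (simp add: less_imp_r)
  then have "word (p (3 / 4)) = Alpha ` {1..d} \<union> Delta ` {1..d}" by (auto simp: word)
  then show "Alpha ` {1..d} \<union> Delta ` {1..d} \<in> range word" by (metis rangeI)
  have "\<not> r (1 / 2) (1 / 4)" using r_imp_le[of "1 / 2" "1 / 4"] by auto
  then have "word (p (1 / 4)) = Delta ` {1..d}" by (simp add: word)
  then show "Delta ` {1..d} \<in> range word" by (metis rangeI)
qed

text \<open>
  On the ray along the \<open>i\<close>-th coordinate axis, pushed slightly into the interior of the tube, the point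
  at height \<open>2\<close> has left the cube but is far below the slab, and the point at height \<open>L\<close> lies in it.
\<close>

lemma petal_words:
  assumes i: "i \<in> {1..d}"
  shows "{Alpha i, Beta i, Gamma i, Delta i} \<in> range word" "{Alpha i, Delta i} \<in> range word"
proof -
  obtain k where k: "c k = i" using obtain_index[OF i] .
  define p :: "real \<Rightarrow> real ^ 'n" where "p e = (\<chi> j. if j = k then e else 1 / real d)" for e
  have tube: "p e \<in> tube r c i" if "0 < e" for e
    using that dim_ge_2 k by (auto simp: tube_def p_def intro!: less_imp_r)
  have tot: "coord_sum (p e) = e + (real d - 1) / real d" for e
    using dim_ge_2
    by (simp add: p_def sum.If_cases Compl_eq_Diff_UNIV card_Diff_subset dim of_nat_diff)
  have frac: "0 < (real d - 1) / real d" "(real d - 1) / real d < 1" using dim_ge_2 by auto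
  have "word (p L) = {Alpha i, Beta i, Gamma i, Delta i}"
    using frac L_ge_40 by (intro word_tube_in_slab i tube less_imp_r) (auto simp: tot)
  then show "{Alpha i, Beta i, Gamma i, Delta i} \<in> range word" by (metis rangeI)
  have "p 2 \<notin> tube r c j" if "j \<noteq> i" for j
    using that k r_imp_le[of 2 1] by (auto simp: tube_def p_def)
  then have "{j \<in> {1..d}. p 2 \<in> tube r c j} = {i}" using tube[of 2] i by auto
  moreover have "p 2 \<notin> slab r c" using frac L_ge_40 by (intro not_in_slabI) (simp add: tot)
  moreover have "r (1 / 2) (coord_sum (p 2))" using frac unfolding tot by (intro less_imp_r) linarith
  ultimately have "word (p 2) = {Alpha i, Delta i}" by (auto simp: word_outside_slab)
  then show "{Alpha i, Delta i} \<in> range word" by (metis rangeI)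
qed

lemma obtain_slab_point_off_tubes:
  assumes "3 / 4 < t" "t < real d + 1 / 4" and away: "\<And>j. 1 / 5 < \<bar>t - real j\<bar>"
  obtains p where "p \<in> slab r c" "\<And>j. j \<in> {1..d} \<Longrightarrow> p \<notin> tube r c j" "position c p = t"
proof -
  obtain p where p: "coord_sum p = L + 1 / 2" "position c p = t" by (rule obtain_point_at_position)
  show thesis
  proof
    show "p \<in> slab r c" using assms(1,2) p by (intro in_slabI) auto
    show "p \<notin> tube r c j" if "j \<in> {1..d}" for j
    proof
      assume "p \<in> tube r c j"
      then have "real j - 1 / 5 \<le> t" "t \<le> real j + 1 / 5" using tube_near[OF that] p by auto
      with away[of j] show False by linarith
    qed
  qed fact
qed

lemma away_from_naturals:
  assumes "1 / 5 < s" "s < 4 / 5"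
  shows "1 / 5 < \<bar>real i + s - real j\<bar>"
proof -
  have "j \<le> i \<or> i + 1 \<le> j" by linarith
  then have "real j \<le> real i \<or> real i + 1 \<le> real j" by auto
  with assms show ?thesis by linarith
qed

lemma between_words:
  assumes i: "i \<in> {1..<d}"
  shows "{Beta i, Beta (i + 1), Gamma i} \<in> range word" "{Beta i, Beta (i + 1)} \<in> range word"
    "{Beta i, Beta (i + 1), Gamma (i + 1)} \<in> range word"
proof -
  have *: "{Beta i, Beta (i + 1)} \<union> (if s < 2 / 5 then {Gamma i} else {}) \<union>
      (if 3 / 5 < s then {Gamma (i + 1)} else {}) \<in> range word"
    if s: "1 / 3 < s" "s < 2 / 3" "s \<noteq> 2 / 5" "s \<noteq> 3 / 5" for s :: real
  proof -
    obtain p where p: "p \<in> slab r c" "\<And>j. j \<in> {1..d} \<Longrightarrow> p \<notin> tube r c j"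
        "position c p = real i + s"
      by (rule obtain_slab_point_off_tubes[OF _ _ away_from_naturals[of s i]]) (use s i in auto)
    have "r (real i + 1 / 3) (position c p)" "r (position c p) (real i + 2 / 3)"
      using s p(3) by (auto intro!: less_imp_r)
    from word_between[OF p(1,2) i this]
    have "word p = {Beta i, Beta (i + 1)} \<union>
        (if r (position c p) (real i + 2 / 5) then {Gamma i} else {}) \<union>
        (if r (real i + 3 / 5) (position c p) then {Gamma (i + 1)} else {})" .
    moreover have "r (position c p) (real i + 2 / 5) \<longleftrightarrow> s < 2 / 5"
      "r (real i + 3 / 5) (position c p) \<longleftrightarrow> 3 / 5 < s"
      using s p(3) by (auto intro!: less_imp_r dest: r_imp_le)
    ultimately have "word p = {Beta i, Beta (i + 1)} \<union> (if s < 2 / 5 then {Gamma i} else {}) \<union>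
        (if 3 / 5 < s then {Gamma (i + 1)} else {})"
      by (simp only:)
    then show ?thesis by (rule range_eqI[OF sym])
  qed
  \<comment> \<open>One sample in each of the three parts \<open>(1 / 3, 2 / 5)\<close>, \<open>(2 / 5, 3 / 5)\<close>, \<open>(3 / 5, 2 / 3)\<close> of the
    overlap.\<close>
  show "{Beta i, Beta (i + 1), Gamma i} \<in> range word"
    using *[of "3 / 8"] by (simp add: insert_commute)
  show "{Beta i, Beta (i + 1)} \<in> range word"
    using *[of "1 / 2"] by simp
  show "{Beta i, Beta (i + 1), Gamma (i + 1)} \<in> range word"
    using *[of "5 / 8"] by (simp add: insert_commute)
qed

lemma vertex_word:
  assumes i: "i \<in> {1..d}"
  shows "{Beta i, Gamma i} \<in> range word"
proof -
  \<comment> \<open>A position at distance \<open>1 / 4\<close> from \<open>i\<close>, beyond the reach \<open>1 / 5\<close> of the tubes but before the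
    overlaps, which begin at distance \<open>1 / 3\<close>. Written as an integer plus a fraction strictly between
    \<open>1 / 5\<close> and \<open>4 / 5\<close>, so that it is visibly away from every integer.\<close>
  define t where "t = (if i < d then real i + 1 / 4 else real (i - 1) + 3 / 4)"
  have t: "real i - 1 / 4 \<le> t" "t \<le> real i + 1 / 4" using i by (auto simp: t_def of_nat_diff)
  have away: "1 / 5 < \<bar>t - real j\<bar>" for j
    unfolding t_def using away_from_naturals[of "1 / 4" i j] away_from_naturals[of "3 / 4" "i - 1" j]
    by simp
  have "3 / 4 < t" "t < real d + 1 / 4" using i dim_ge_2 by (auto simp: t_def of_nat_diff)
  from obtain_slab_point_off_tubes[OF this away]
  obtain p where p: "p \<in> slab r c" "\<And>j. j \<in> {1..d} \<Longrightarrow> p \<notin> tube r c j" "position c p = t"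
    by blast
  have "word p = {Beta i, Gamma i}"
    by (rule word_near_vertex[OF p(1,2) i]) (use t p(3) in \<open>auto dest!: r_imp_le\<close>)
  then show ?thesis by (metis rangeI)
qed

lemma code_of_layout: "code_of (base_2dd d) (layout r c) = code_2dd d"
proof
  show "code_of (base_2dd d) (layout r c) \<subseteq> code_2dd d"
    using word_in_code by (auto simp: code_of_eq_range)
  show "code_2dd d \<subseteq> code_of (base_2dd d) (layout r c)"
  proof
    fix \<sigma>
    assume "\<sigma> \<in> code_2dd d"
    then show "\<sigma> \<in> code_of (base_2dd d) (layout r c)"
      unfolding code_of_eq_range code_2dd_def Un_iff mem_Collect_eq singleton_iff
      by (elim disjE exE conjE)
        (simp_all only: empty_word center_words petal_words between_words vertex_word)
  qed
qed

end

section \<open>The realization\<close>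

theorem proposition3p4:
  fixes d :: nat
  assumes "2 \<le> d" and "CARD('n::finite) = d"
  shows "\<exists>U :: symb \<Rightarrow> (real ^ 'n) set.
           nondegenerate_convex_realization (code_2dd d) (base_2dd d) U"
proof -
  obtain c :: "'n \<Rightarrow> nat" where c: "bij_betw c UNIV {1..d}"
    using finite_same_card_bij[of "UNIV :: 'n set" "{1..d}"] assms(2) by auto
  interpret numbered_coordinates c d
    by unfold_locales (use assms c in auto)
  interpret weak: loose_comparison c d "(\<le>)" by unfold_locales auto
  interpret strict: loose_comparison c d "(<)" by unfold_locales auto
  have "nondegenerate_closed (base_2dd d) (layout (\<le>) c)"
    by (simp add: nondegenerate_closed_def convex_layout closed_layout interior_layout
        weak.code_of_layout strict.code_of_layout)
  then show ?thesis
    using weak.code_of_layout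
    by (auto simp: nondegenerate_convex_realization_def realization_def)
qed

end
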